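(* Let $G$ be a connected graph. Then $tmc(G)=6$ if and only if one of the following holds: $G=K_3$; $G$ is a tree with $l(G)=5$; $G$ is a unicyclic graph with $l(G)=4$; or $G$ is a bicyclic graph with $l(G)=3$ other than $K_{2,1,1}$ (i.e. $K_4$ minus an edge).
   Context: All graphs are simple, finite and undirected; $n$ and $m$ denote the number of vertices and edges. A graph is total-colored if all its edges and all its vertices are assigned colors. A path in a total-colored graph is a total monochromatic path if all its edges and all its internal vertices have the same color. A total-coloring is a TMC-coloring if any two vertices are connected by a total monochromatic path. For a connected graph $G$, $tmc(G)$ is the maximum number of colors used in a TMC-coloring of $G$. For a tree $T$, $l(T)$ is its number of leaves, and for a connected graph $G$, $l(G)=\max\{l(T): T \text{ a spanning tree of } G\}$. A connected graph is unicyclic if $m=n$ and bicyclic if $m=n+1$. (The paper depicts the unicyclic graphs with $l(G)=4$ as $\mathcal{H}_1,\dots,\mathcal{H}_{13}$ and the bicyclic graphs with $l(G)=3$ other than $K_{2,1,1}$ as $\mathcal{H}_{14},\dots,\mathcal{H}_{18}$ in a figure.) *)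

theory Defs
  imports Main
begin

datatype 'a graph = Graph (verts: "'a set") (edges: "'a set set")

definition all_edges :: "'a set \<Rightarrow> 'a set set" where
  "all_edges V = {e. e \<subseteq> V \<and> card e = 2}"

definition simple_graph :: "'a graph \<Rightarrow> bool" where
  "simple_graph G \<longleftrightarrow> finite (verts G) \<and> edges G \<subseteq> all_edges (verts G)"

definition is_path :: "'a graph \<Rightarrow> 'a list \<Rightarrow> bool" where
  "is_path G p \<longleftrightarrow> p \<noteq> [] \<and> distinct p \<and> set p \<subseteq> verts G \<and>
     (\<forall>i. Suc i < length p \<longrightarrow> {p ! i, p ! Suc i} \<in> edges G)"

definition path_between :: "'a graph \<Rightarrow> 'a \<Rightarrow> 'a list \<Rightarrow> 'a \<Rightarrow> bool" where
  "path_between G u p v \<longleftrightarrow> is_path G p \<and> hd p = u \<and> last p = v"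

definition path_edges :: "'a list \<Rightarrow> 'a set set" where
  "path_edges p = {{p ! i, p ! Suc i} |i. Suc i < length p}"

definition internal_verts :: "'a list \<Rightarrow> 'a set" where
  "internal_verts p = set (butlast (tl p))"

definition connected_graph :: "'a graph \<Rightarrow> bool" where
  "connected_graph G \<longleftrightarrow> simple_graph G \<and> verts G \<noteq> {} \<and>
     (\<forall>u\<in>verts G. \<forall>v\<in>verts G. \<exists>p. path_between G u p v)"

definition is_cycle :: "'a graph \<Rightarrow> 'a list \<Rightarrow> bool" where
  "is_cycle G p \<longleftrightarrow> is_path G p \<and> 3 \<le> length p \<and> {last p, hd p} \<in> edges G"

definition tree :: "'a graph \<Rightarrow> bool" where
  "tree T \<longleftrightarrow> connected_graph T \<and> (\<nexists>p. is_cycle T p)"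

definition degree :: "'a graph \<Rightarrow> 'a \<Rightarrow> nat" where
  "degree G v = card {e \<in> edges G. v \<in> e}"

definition num_leaves :: "'a graph \<Rightarrow> nat" where
  "num_leaves T = card {v \<in> verts T. degree T v = 1}"

definition spanning_tree :: "'a graph \<Rightarrow> 'a graph \<Rightarrow> bool" where
  "spanning_tree T G \<longleftrightarrow> tree T \<and> verts T = verts G \<and> edges T \<subseteq> edges G"

(* For connected G the set below is finite and nonempty, so Max is meaningful. *)
definition max_leaves :: "'a graph \<Rightarrow> nat" where
  "max_leaves G = Max {num_leaves T |T. spanning_tree T G}"

definition unicyclic :: "'a graph \<Rightarrow> bool" where
  "unicyclic G \<longleftrightarrow> connected_graph G \<and> card (edges G) = card (verts G)"

definition bicyclic :: "'a graph \<Rightarrow> bool" where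
  "bicyclic G \<longleftrightarrow> connected_graph G \<and> card (edges G) = card (verts G) + 1"

(* A total-coloring is a pair of color maps, cv on vertices and ce on edges, into a
   common palette. The values of cv and ce outside G are irrelevant. *)
definition total_mono_path ::
  "('a \<Rightarrow> nat) \<Rightarrow> ('a set \<Rightarrow> nat) \<Rightarrow> 'a list \<Rightarrow> bool" where
  "total_mono_path cv ce p \<longleftrightarrow>
     (\<exists>k. (\<forall>e\<in>path_edges p. ce e = k) \<and> (\<forall>w\<in>internal_verts p. cv w = k))"

definition TMC_coloring :: "'a graph \<Rightarrow> ('a \<Rightarrow> nat) \<Rightarrow> ('a set \<Rightarrow> nat) \<Rightarrow> bool" where
  "TMC_coloring G cv ce \<longleftrightarrow>
     (\<forall>u\<in>verts G. \<forall>v\<in>verts G. u \<noteq> v \<longrightarrow>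
        (\<exists>p. path_between G u p v \<and> total_mono_path cv ce p))"

definition num_colors :: "'a graph \<Rightarrow> ('a \<Rightarrow> nat) \<Rightarrow> ('a set \<Rightarrow> nat) \<Rightarrow> nat" where
  "num_colors G cv ce = card (cv ` verts G \<union> ce ` edges G)"

(* For connected G the set below is nonempty (color everything alike) and bounded
   by the number of vertices plus the number of edges, so Max is meaningful. *)
definition tmc :: "'a graph \<Rightarrow> nat" where
  "tmc G = Max {num_colors G cv ce |cv ce. TMC_coloring G cv ce}"

definition graph_iso :: "'a graph \<Rightarrow> 'b graph \<Rightarrow> bool" where
  "graph_iso G H \<longleftrightarrow>
     (\<exists>f. bij_betw f (verts G) (verts H) \<and> edges H = (\<lambda>e. f ` e) ` edges G)"

definition complete_graph :: "nat \<Rightarrow> nat graph" where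
  "complete_graph n = Graph {..<n} (all_edges {..<n})"

(* The vertex (i, j) is the j-th vertex of the i-th part, which has ns ! i elements. *)
definition complete_multipartite :: "nat list \<Rightarrow> (nat \<times> nat) graph" where
  "complete_multipartite ns =
     (let V = {(i, j). i < length ns \<and> j < ns ! i}
      in Graph V {{x, y} |x y. x \<in> V \<and> y \<in> V \<and> fst x \<noteq> fst y})"

end

theory Submission
  imports Defs
begin

text \<open>
Coloring a spanning tree with the maximal number of leaves, minus these leaves, in one color and all
else differently gives \<open>m - n + 2 + l(G)\<close> colors. Conversely, the color classes of a TMC-coloring
cut the vertices into connected monochromatic pieces. If a piece together with its incident edges of
the same color spans \<open>a + 1\<close> vertices, it joins at most \<open>a (a - 1) / 2\<close> non-adjacent pairs and loses
at least \<open>max a (2 a - l(G))\<close> colors; the widths \<open>a\<close> sum to at most \<open>m\<close>. When \<open>m \<le> n + 1\<close> and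
\<open>m + 4 \<le> 2 n\<close>, all non-adjacent pairs can only be joined if some piece has \<open>a = n - 1\<close>, or one has
\<open>a = n - 2\<close> and another \<open>a \<ge> 2\<close>; either way the lower bound is sharp. The only other graphs with
\<open>n \<le> m \<le> n + 1\<close> are the triangle and the diamond \<open>K\<^sub>4 - e\<close>. If \<open>m > n + 1\<close>, a vertex of degree
at least 3 forces \<open>l(G) \<ge> 3\<close>, so \<open>tmc(G) \<ge> 7\<close>.
\<close>

section \<open>Trees grown by pendant vertices\<close>

text \<open>Building trees by adding leaves makes connectedness, acyclicity and the edge count plain
  inductions, and lets leaves be tracked during growth. \<open>gtree_imp_tree\<close> and
  \<open>tree_imp_gtree\<close> identify this notion with \<open>tree\<close>.\<close>

inductive gtree :: "'a set \<Rightarrow> 'a set set \<Rightarrow> bool" where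
  single: "gtree {v} {}"
| pendant: "gtree V E \<Longrightarrow> w \<in> V \<Longrightarrow> v \<notin> V \<Longrightarrow> gtree (insert v V) (insert {v, w} E)"

lemma all_edges_mono: "A \<subseteq> B \<Longrightarrow> all_edges A \<subseteq> all_edges B"
  by (auto simp: all_edges_def)

lemma doubleton_in_all_edges: "{x, y} \<in> all_edges V \<longleftrightarrow> x \<in> V \<and> y \<in> V \<and> x \<noteq> y"
  by (auto simp: all_edges_def card_insert_if)

lemma all_edgesE:
  assumes "e \<in> all_edges V" "x \<in> e"
  obtains y where "e = {x, y}" "y \<in> V" "x \<noteq> y" "x \<in> V"
proof -
  from assms obtain a b where "e = {a, b}" "a \<noteq> b" "a \<in> V" "b \<in> V"
    by (auto simp: all_edges_def card_2_iff)
  then show ?thesis using that[of a] that[of b] assms(2) by (auto simp: insert_commute)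
qed

lemma finite_all_edges: "finite V \<Longrightarrow> finite (all_edges V)"
  by (rule finite_subset[of _ "Pow V"]) (auto simp: all_edges_def)

lemma card_all_edges: "finite V \<Longrightarrow> card (all_edges V) = card V choose 2"
  unfolding all_edges_def by (rule n_subsets)

lemma gtree_facts:
  assumes "gtree V E"
  shows "finite V" "finite E" "V \<noteq> {}" "E \<subseteq> all_edges V" "card V = Suc (card E)"
proof -
  have "finite V \<and> finite E \<and> V \<noteq> {} \<and> E \<subseteq> all_edges V \<and> card V = Suc (card E)"
    using assms
  proof (induction)
    case (single v)
    then show ?case by simp
  next
    case (pendant V E w v)
    have "{v, w} \<notin> E" using pendant by (auto simp: all_edges_def)
    moreover have "insert {v, w} E \<subseteq> all_edges (insert v V)"
      using pendant all_edges_mono[of V "insert v V"] by (auto simp: doubleton_in_all_edges)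
    ultimately show ?case using pendant by simp
  qed
  then show "finite V" "finite E" "V \<noteq> {}" "E \<subseteq> all_edges V" "card V = Suc (card E)" by auto
qed

section \<open>Connectedness and acyclicity of grown trees\<close>

lemma path_append:
  assumes p: "is_path (Graph V E) p" and "last p = w" "{v, w} \<in> E'" "v \<notin> V" "v \<in> V'" "V \<subseteq> V'" "E \<subseteq> E'"
  shows "is_path (Graph V' E') (p @ [v])"
proof -
  have d: "p \<noteq> []" "distinct p" "set p \<subseteq> V" "\<And>i. Suc i < length p \<Longrightarrow> {p ! i, p ! Suc i} \<in> E"
    using p by (simp_all add: is_path_def)
  have "{(p @ [v]) ! i, (p @ [v]) ! Suc i} \<in> E'" if "Suc i < length (p @ [v])" for i
  proof (cases "Suc i < length p")
    case True
    then show ?thesis using d(4)[OF True] assms(7) by (simp add: nth_append subset_iff)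
  next
    case False
    then have "i = length p - 1" "i < length p" "Suc i = length p" using that d(1) by auto
    then show ?thesis
      using assms(2,3) last_conv_nth[OF d(1)] by (simp add: nth_append insert_commute)
  qed
  moreover have "v \<notin> set p" "set p \<subseteq> V'" using d(3) assms(4,6) by blast+
  ultimately show ?thesis using d(1,2) assms(5) by (simp add: is_path_def)
qed

lemma path_prepend:
  assumes p: "is_path (Graph V E) p" and "hd p = w" "{v, w} \<in> E'" "v \<notin> V" "v \<in> V'" "V \<subseteq> V'" "E \<subseteq> E'"
  shows "is_path (Graph V' E') (v # p)"
proof -
  have d: "p \<noteq> []" "distinct p" "set p \<subseteq> V" "\<And>i. Suc i < length p \<Longrightarrow> {p ! i, p ! Suc i} \<in> E"
    using p by (simp_all add: is_path_def)
  have "{(v # p) ! i, (v # p) ! Suc i} \<in> E'" if "Suc i < length (v # p)" for i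
  proof (cases i)
    case 0
    then show ?thesis using assms(2,3) hd_conv_nth[OF d(1)] by simp
  next
    case (Suc j)
    then show ?thesis using d(4)[of j] that assms(7) by (auto simp: subset_iff)
  qed
  moreover have "v \<notin> set p" "set p \<subseteq> V'" using d(3) assms(4,6) by blast+
  ultimately show ?thesis using d(1,2) assms(5) by (simp add: is_path_def)
qed

lemma is_path_mono:
  assumes "is_path G p" "verts G \<subseteq> verts H" "edges G \<subseteq> edges H"
  shows "is_path H p"
  using assms unfolding is_path_def by blast

lemma gtree_connected: "gtree V E \<Longrightarrow> u \<in> V \<Longrightarrow> v \<in> V \<Longrightarrow> \<exists>p. path_between (Graph V E) u p v"
proof (induction arbitrary: u v rule: gtree.induct)
  case (single x)
  then show ?case by (intro exI[of _ "[x]"]) (simp add: path_between_def is_path_def)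
next
  case (pendant V E w x)
  let ?H = "Graph (insert x V) (insert {x, w} E)"
  consider "u \<in> V" "v \<in> V" | "u \<in> V" "v = x" | "u = x" "v \<in> V" | "u = x" "v = x"
    using pendant.prems by blast
  then show ?case
  proof cases
    case 1
    then obtain p where "path_between (Graph V E) u p v" using pendant.IH by blast
    then have "path_between ?H u p v"
      unfolding path_between_def using is_path_mono[of "Graph V E" p ?H] by auto
    then show ?thesis by blast
  next
    case 2
    then obtain p where p: "path_between (Graph V E) u p w" using pendant by blast
    then have "p \<noteq> []" by (auto simp: path_between_def is_path_def)
    then have "path_between ?H u (p @ [x]) v"
      using p 2 pendant.hyps path_append[of V E p w x "edges ?H" "verts ?H"]
      by (auto simp: path_between_def)
    then show ?thesis by blast
  next
    case 3
    then obtain p where p: "path_between (Graph V E) w p v" using pendant by blast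
    then have "p \<noteq> []" by (auto simp: path_between_def is_path_def)
    then have "path_between ?H u (x # p) v"
      using p 3 pendant.hyps path_prepend[of V E p w x "edges ?H" "verts ?H"]
      by (auto simp: path_between_def)
    then show ?thesis by blast
  next
    case 4
    then show ?thesis by (intro exI[of _ "[x]"]) (simp add: path_between_def is_path_def)
  qed
qed

text \<open>The neighbours are the predecessor and the successor on the cycle; at either end of the
  list one of them comes from the closing edge. This keeps vertices with a single edge off all
  cycles.\<close>

lemma cycle_neighbours:
  assumes "is_cycle G p" "v \<in> set p"
  obtains a b where "a \<noteq> b" "{v, a} \<in> edges G" "{v, b} \<in> edges G"
proof -
  obtain i where i: "i < length p" "p ! i = v" using assms(2) by (auto simp: in_set_conv_nth)
  have d: "distinct p" and len: "3 \<le> length p" and ne: "p \<noteq> []"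
    and E: "\<And>i. Suc i < length p \<Longrightarrow> {p ! i, p ! Suc i} \<in> edges G"
    and cl: "{p ! (length p - 1), p ! 0} \<in> edges G"
    using assms(1) by (auto simp: is_cycle_def is_path_def last_conv_nth hd_conv_nth)
  consider "i = 0" | "i = length p - 1" "i \<noteq> 0" | j where "i = Suc j" "Suc i < length p"
    using i by (cases i) force+
  then show ?thesis
  proof cases
    case 1
    show ?thesis
      by (rule that[of "p ! 1" "p ! (length p - 1)"])
         (use 1 i E[of 0] cl d len in \<open>auto simp: nth_eq_iff_index_eq insert_commute\<close>)
  next
    case 2
    show ?thesis
    proof (rule that[of "p ! 0" "p ! (length p - 2)"])
      show "p ! 0 \<noteq> p ! (length p - 2)"
        using d len ne by (subst nth_eq_iff_index_eq) auto
      show "{v, p ! 0} \<in> edges G" using cl 2 i by simp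
      have "Suc (length p - 2) = length p - 1" using len by simp
      then show "{v, p ! (length p - 2)} \<in> edges G"
        using E[of "length p - 2"] 2 i len by (auto simp: insert_commute)
    qed
  next
    case 3
    show ?thesis
      by (rule that[of "p ! j" "p ! Suc i"])
         (use 3 i E[of j] E[of i] d in \<open>auto simp: nth_eq_iff_index_eq insert_commute\<close>)
  qed
qed

text \<open>A freshly attached vertex has only one incident edge, so a cycle avoids it and would
  already exist in the smaller tree.\<close>

lemma gtree_acyclic: "gtree V E \<Longrightarrow> \<not> is_cycle (Graph V E) p"
proof (induction arbitrary: p rule: gtree.induct)
  case (single v)
  then show ?case by (auto simp: is_cycle_def is_path_def)
next
  case (pendant V E w v)
  let ?H = "Graph (insert v V) (insert {v, w} E)"
  have noE: "v \<notin> e" if "e \<in> E" for e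
    using gtree_facts(4)[OF pendant.hyps(1)] that pendant.hyps by (auto simp: all_edges_def)
  show ?case
  proof
    assume c: "is_cycle ?H p"
    have vp: "v \<notin> set p"
    proof
      assume "v \<in> set p"
      then obtain a b where ab: "a \<noteq> b" "{v, a} \<in> edges ?H" "{v, b} \<in> edges ?H"
        using cycle_neighbours[OF c] by blast
      have "{v, a} = {v, w}" "{v, b} = {v, w}" using ab noE by auto
      then show False using ab(1) by (metis doubleton_eq_iff)
    qed
    have p: "p \<noteq> []" using c by (auto simp: is_cycle_def is_path_def)
    have "{p ! i, p ! Suc i} \<noteq> {v, w}" if "Suc i < length p" for i
      using vp that by (metis Suc_lessD insertCI insertE nth_mem singletonD)
    moreover have "{last p, hd p} \<noteq> {v, w}"
      using vp p by (metis hd_in_set insertCI insertE last_in_set singletonD)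
    ultimately have "is_cycle (Graph V E) p"
      using c vp by (auto simp: is_cycle_def is_path_def)
    then show False using pendant.IH by blast
  qed
qed

lemma gtree_imp_tree:
  assumes "gtree V E"
  shows "tree (Graph V E)"
  using gtree_facts[OF assms] gtree_connected[OF assms] gtree_acyclic[OF assms]
  by (auto simp: tree_def connected_graph_def simple_graph_def)

lemma degree_pendant:
  assumes "finite E" "{v, w} \<notin> E"
  shows "degree (Graph V' (insert {v, w} E)) x = degree (Graph V E) x + (if x = v \<or> x = w then 1 else 0)"
proof -
  have "{e \<in> insert {v, w} E. x \<in> e} =
    (if x = v \<or> x = w then insert {v, w} {e \<in> E. x \<in> e} else {e \<in> E. x \<in> e})" by auto
  then show ?thesis using assms by (simp add: degree_def)
qed

text \<open>The vertex \<open>w\<close> may stop being a leaf, but the new vertex \<open>v\<close>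
  is one and makes up for it; all other degrees stay the same.\<close>

lemma num_leaves_pendant:
  assumes "gtree V E" "w \<in> V" "v \<notin> V"
  shows "num_leaves (Graph V E) \<le> num_leaves (Graph (insert v V) (insert {v, w} E))"
proof -
  note f = gtree_facts[OF assms(1)]
  let ?H = "Graph (insert v V) (insert {v, w} E)"
  let ?L = "{x \<in> V. degree (Graph V E) x = 1}"
  have vE: "{v, w} \<notin> E" "degree (Graph V E) v = 0"
    using f assms by (auto simp: all_edges_def degree_def)
  note d = degree_pendant[OF f(2) vE(1), of "insert v V" _ V]
  have "insert v (?L - {w}) \<subseteq> {x \<in> verts ?H. degree ?H x = 1}"
    using assms vE(2) by (auto simp: d)
  then have "card (insert v (?L - {w})) \<le> num_leaves ?H"
    unfolding num_leaves_def using f(1) by (intro card_mono) auto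
  moreover have "card ?L \<le> card (insert v (?L - {w}))"
  proof -
    have "card ?L \<le> card (insert w (?L - {w}))" using f(1) by (intro card_mono) auto
    also have "\<dots> \<le> Suc (card (?L - {w}))"
      using f(1) by (subst card_insert_if) auto
    finally have "card ?L \<le> Suc (card (?L - {w}))" .
    moreover have "card (insert v (?L - {w})) = Suc (card (?L - {w}))"
      using assms(3) f(1) by (intro card_insert_disjoint) auto
    ultimately show ?thesis by linarith
  qed
  ultimately show ?thesis by (simp add: num_leaves_def)
qed

section \<open>Extending a tree without losing leaves\<close>

lemma rtrancl_crossing:
  assumes "(x, y) \<in> r\<^sup>*" "x \<in> W" "y \<notin> W"
  obtains a b where "(x, a) \<in> r\<^sup>*" "(a, b) \<in> r" "a \<in> W" "b \<notin> W"
  using assms by (induction rule: rtrancl_induct) blast+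

text \<open>As long as a vertex is missing, some step of \<open>r\<close> leaves the tree and
  supplies a pendant vertex. The relation is kept abstract because the lemma serves both adjacency
  in the graph and adjacency within one color.\<close>

lemma gtree_extend:
  assumes "gtree V0 E0" "V0 \<subseteq> U" "finite U" "\<And>y. y \<in> U \<Longrightarrow> \<exists>x\<in>V0. (x, y) \<in> r\<^sup>*" "r `` U \<subseteq> U"
  shows "\<exists>E. gtree U E \<and> E \<subseteq> E0 \<union> {{b, a} |a b. (a, b) \<in> r \<and> a \<in> U} \<and>
    num_leaves (Graph V0 E0) \<le> num_leaves (Graph U E)"
  using assms
proof (induction "card (U - V0)" arbitrary: V0 E0)
  case 0
  then have "V0 = U" by auto
  then show ?case using 0 by blast
next
  case (Suc k)
  then obtain y where y: "y \<in> U" "y \<notin> V0" by (metis card.empty Diff_eq_empty_iff nat.distinct(1) subsetI)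
  then obtain x where x: "x \<in> V0" "(x, y) \<in> r\<^sup>*" using Suc.prems by blast
  then obtain a b where ab: "(a, b) \<in> r" "a \<in> V0" "b \<notin> V0" using rtrancl_crossing[OF x(2,1) y(2)] by blast
  then have bU: "b \<in> U" using Suc.prems by blast
  let ?V = "insert b V0" and ?E = "insert {b, a} E0"
  have g: "gtree ?V ?E" using Suc.prems ab by (intro gtree.pendant)
  have "U - ?V = (U - V0) - {b}" by auto
  then have "k = card (U - ?V)" using Suc.hyps(2) ab bU Suc.prems(3) by simp
  moreover have "\<And>y. y \<in> U \<Longrightarrow> \<exists>x\<in>?V. (x, y) \<in> r\<^sup>*" using Suc.prems(4) by blast
  ultimately obtain E where E: "gtree U E" "E \<subseteq> ?E \<union> {{b, a} |a b. (a, b) \<in> r \<and> a \<in> U}"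
      "num_leaves (Graph ?V ?E) \<le> num_leaves (Graph U E)"
    using Suc.hyps(1)[of ?V ?E] g bU Suc.prems by blast
  moreover have "E \<subseteq> E0 \<union> {{b, a} |a b. (a, b) \<in> r \<and> a \<in> U}" using E(2) ab Suc.prems(2) by blast
  moreover have "num_leaves (Graph V0 E0) \<le> num_leaves (Graph U E)"
    using num_leaves_pendant[OF Suc.prems(1) ab(2,3)] E(3) by linarith
  ultimately show ?case by blast
qed

text \<open>Each vertex of \<open>S\<close> is hung on a vertex of \<open>D\<close> by its only
  edge, so all of \<open>S\<close> becomes leaves. This is applied to the star of a vertex and to
  the outer vertices of a monochromatic piece.\<close>

lemma gtree_attach:
  assumes "gtree D E" "finite S" "S \<inter> D = {}" "f ` S \<subseteq> D"
  shows "gtree (D \<union> S) (E \<union> (\<lambda>s. {s, f s}) ` S)"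
    and "card S \<le> num_leaves (Graph (D \<union> S) (E \<union> (\<lambda>s. {s, f s}) ` S))"
proof -
  show g: "gtree (D \<union> S) (E \<union> (\<lambda>s. {s, f s}) ` S)"
    using assms(2,3,4)
  proof (induction S)
    case empty
    then show ?case using assms(1) by simp
  next
    case (insert s S)
    have "gtree (insert s (D \<union> S)) (insert {s, f s} (E \<union> (\<lambda>s. {s, f s}) ` S))"
      using insert by (intro gtree.pendant) auto
    then show ?case by simp
  qed
  have "{e \<in> E \<union> (\<lambda>s. {s, f s}) ` S. x \<in> e} = {{x, f x}}" if "x \<in> S" for x
    using that assms(3,4) gtree_facts(4)[OF assms(1)] by (auto simp: all_edges_def)
  then have "S \<subseteq> {x \<in> D \<union> S. degree (Graph (D \<union> S) (E \<union> (\<lambda>s. {s, f s}) ` S)) x = 1}"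
    by (auto simp: degree_def)
  then show "card S \<le> num_leaves (Graph (D \<union> S) (E \<union> (\<lambda>s. {s, f s}) ` S))"
    unfolding num_leaves_def using gtree_facts(1)[OF g] by (intro card_mono) auto
qed

lemma path_rtrancl:
  assumes "\<And>i. s \<le> i \<Longrightarrow> i < t \<Longrightarrow> (p ! i, p ! Suc i) \<in> r" "s \<le> t"
  shows "(p ! s, p ! t) \<in> r\<^sup>*"
  using assms(2,1) by (induction t rule: dec_induct) (auto intro: rtrancl_into_rtrancl)

section \<open>Spanning trees of a connected graph\<close>

lemma connected_graph_facts:
  assumes "connected_graph G"
  shows "finite (verts G)" "finite (edges G)" "edges G \<subseteq> all_edges (verts G)" "verts G \<noteq> {}"
  using assms finite_subset[OF _ finite_all_edges] unfolding connected_graph_def simple_graph_def by blast+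

lemma connected_graphD:
  "connected_graph G \<Longrightarrow> u \<in> verts G \<Longrightarrow> v \<in> verts G \<Longrightarrow> \<exists>p. path_between G u p v"
  unfolding connected_graph_def by blast

lemma edge_ends:
  assumes "edges G \<subseteq> all_edges (verts G)" "{x, y} \<in> edges G"
  shows "x \<in> verts G" "y \<in> verts G" "x \<noteq> y"
  using subsetD[OF assms] by (simp_all add: doubleton_in_all_edges)

lemma connected_gtree_extend:
  assumes "connected_graph G" "gtree V0 E0" "V0 \<subseteq> verts G" "E0 \<subseteq> edges G"
  obtains E where "gtree (verts G) E" "E \<subseteq> edges G"
    "num_leaves (Graph V0 E0) \<le> num_leaves (Graph (verts G) E)"
proof -
  note f = connected_graph_facts[OF assms(1)]
  define r where "r = {(a, b). {b, a} \<in> edges G}"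
  have "\<exists>x\<in>V0. (x, y) \<in> r\<^sup>*" if y: "y \<in> verts G" for y
  proof -
    obtain x where x: "x \<in> V0" using gtree_facts(3)[OF assms(2)] by blast
    then have "x \<in> verts G" using assms(3) by blast
    then obtain p where "path_between G x p y"
      using connected_graphD[OF assms(1) _ y] by blast
    then have pb: "p \<noteq> []" "hd p = x" "last p = y"
      "\<And>i. Suc i < length p \<Longrightarrow> {p ! i, p ! Suc i} \<in> edges G"
      unfolding path_between_def is_path_def by blast+
    then have p: "p ! 0 = x" "p ! (length p - 1) = y"
      using hd_conv_nth[OF pb(1)] last_conv_nth[OF pb(1)] by simp_all
    have "(p ! 0, p ! (length p - 1)) \<in> r\<^sup>*"
      by (rule path_rtrancl) (use pb(4) in \<open>auto simp: r_def insert_commute\<close>)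
    then have "(x, y) \<in> r\<^sup>*" using p by simp
    then show ?thesis using x by blast
  qed
  moreover have "r `` verts G \<subseteq> verts G" using edge_ends(1)[OF f(3)] by (auto simp: r_def)
  ultimately obtain E where E: "gtree (verts G) E" "E \<subseteq> E0 \<union> {{b, a} |a b. (a, b) \<in> r \<and> a \<in> verts G}"
      "num_leaves (Graph V0 E0) \<le> num_leaves (Graph (verts G) E)"
    using gtree_extend[OF assms(2,3) f(1)] by blast
  have "E \<subseteq> edges G" using E(2) assms(4) by (auto simp: r_def)
  then show ?thesis using E(1,3) that by simp
qed

lemma connected_gtree:
  assumes "connected_graph G"
  obtains E where "gtree (verts G) E" "E \<subseteq> edges G"
proof -
  obtain v where "v \<in> verts G" using connected_graph_facts(4)[OF assms] by blast
  then obtain E where "gtree (verts G) E" "E \<subseteq> edges G"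
    by (rule_tac connected_gtree_extend[OF assms gtree.single[of v]]) auto
  then show ?thesis by (rule that)
qed

text \<open>An edge outside a grown spanning tree would close a cycle with the tree path between its
  ends.\<close>

lemma tree_imp_gtree:
  assumes "tree G"
  shows "gtree (verts G) (edges G)"
proof -
  have c: "connected_graph G" using assms by (simp add: tree_def)
  obtain E where E: "gtree (verts G) E" "E \<subseteq> edges G" using connected_gtree[OF c] .
  have "edges G \<subseteq> E"
  proof
    fix e assume e: "e \<in> edges G"
    then obtain u v where uv: "e = {u, v}" "u \<in> verts G" "v \<in> verts G" "u \<noteq> v"
      using connected_graph_facts(3)[OF c] by (force simp: all_edges_def card_2_iff)
    then obtain p where p: "path_between (Graph (verts G) E) u p v" using gtree_connected[OF E(1)] by blast
    show "e \<in> E"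
    proof (rule ccontr)
      assume ne: "e \<notin> E"
      have pp: "p \<noteq> []" "hd p = u" "last p = v" "is_path G p"
        and pE: "\<And>i. Suc i < length p \<Longrightarrow> {p ! i, p ! Suc i} \<in> E"
        using p E(2) by (auto simp: path_between_def is_path_def)
      \<comment> \<open>Length 1 would identify the ends of \<open>e\<close>, and length 2 would
        make \<open>e\<close> itself an edge of the grown tree.\<close>
      have "length p \<noteq> 1" using pp uv(4) by (auto simp: length_Suc_conv)
      moreover have "length p \<noteq> 2"
        using pE[of 0] ne uv(1) pp by (auto simp: hd_conv_nth last_conv_nth)
      moreover have "length p \<noteq> 0" using pp by simp
      ultimately have "3 \<le> length p" by linarith
      then have "is_cycle G p" using pp e uv(1) by (simp add: is_cycle_def insert_commute)
      then show False using assms by (auto simp: tree_def)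
    qed
  qed
  then show ?thesis using E by (metis subset_antisym)
qed

text \<open>A grown spanning tree has one edge less than it has vertices; when the graph has no more
  edges than that, it coincides with this tree.\<close>

lemma connected_card_edges:
  assumes "connected_graph G"
  shows "card (verts G) \<le> Suc (card (edges G))"
    and "tree G \<longleftrightarrow> card (verts G) = Suc (card (edges G))"
proof -
  note f = connected_graph_facts[OF assms]
  obtain E where E: "gtree (verts G) E" "E \<subseteq> edges G" using connected_gtree[OF assms] .
  have le: "card E \<le> card (edges G)" using E f by (intro card_mono)
  then show "card (verts G) \<le> Suc (card (edges G))" using gtree_facts(5)[OF E(1)] by simp
  show "tree G \<longleftrightarrow> card (verts G) = Suc (card (edges G))"
  proof
    assume "tree G" then show "card (verts G) = Suc (card (edges G))"
      using tree_imp_gtree gtree_facts(5) by blast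
  next
    assume "card (verts G) = Suc (card (edges G))"
    then have "E = edges G" using gtree_facts(5)[OF E(1)] E(2) f(2) by (simp add: card_subset_eq)
    then show "tree G" using gtree_imp_tree[OF E(1)] by (cases G) simp
  qed
qed

section \<open>The maximal number of leaves\<close>

lemma finite_leaf_counts:
  assumes "finite (verts G)"
  shows "finite {num_leaves T |T. spanning_tree T G}"
proof (rule finite_subset)
  show "{num_leaves T |T. spanning_tree T G} \<subseteq> {..card (verts G)}"
    using assms by (auto simp: spanning_tree_def num_leaves_def intro!: card_mono)
qed simp

lemma max_leaves_attained:
  assumes "connected_graph G"
  obtains T where "spanning_tree T G" "num_leaves T = max_leaves G"
proof -
  obtain E where "gtree (verts G) E" "E \<subseteq> edges G" using connected_gtree[OF assms] .
  then have "spanning_tree (Graph (verts G) E) G" by (simp add: spanning_tree_def gtree_imp_tree)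
  then have "{num_leaves T |T. spanning_tree T G} \<noteq> {}" by blast
  from Max_in[OF finite_leaf_counts this] show ?thesis
    using connected_graph_facts(1)[OF assms] that unfolding max_leaves_def by auto
qed

text \<open>The subtree grows to a spanning tree, and growth never lowers the number of leaves. All
  later bounds on \<open>max_leaves\<close> from below by a local structure rest on this.\<close>

lemma subtree_leaves_le_max_leaves:
  assumes "connected_graph G" "gtree V0 E0" "V0 \<subseteq> verts G" "E0 \<subseteq> edges G"
  shows "num_leaves (Graph V0 E0) \<le> max_leaves G"
proof -
  obtain E where E: "gtree (verts G) E" "E \<subseteq> edges G"
    "num_leaves (Graph V0 E0) \<le> num_leaves (Graph (verts G) E)"
    using connected_gtree_extend[OF assms] .
  then have "spanning_tree (Graph (verts G) E) G" by (simp add: spanning_tree_def gtree_imp_tree)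
  then have "num_leaves (Graph (verts G) E) \<le> max_leaves G"
    unfolding max_leaves_def using finite_leaf_counts connected_graph_facts(1)[OF assms(1)]
    by (intro Max_ge) auto
  then show ?thesis using E(3) by linarith
qed

lemma max_leaves_tree:
  assumes "tree G"
  shows "max_leaves G = num_leaves G"
proof -
  have c: "connected_graph G" using assms by (simp add: tree_def)
  obtain T where T: "spanning_tree T G" "num_leaves T = max_leaves G" using max_leaves_attained[OF c] .
  have "tree T" "verts T = verts G" using T(1) by (simp_all add: spanning_tree_def)
  then have "card (edges T) = card (edges G)"
    using gtree_facts(5)[OF tree_imp_gtree[OF assms]] gtree_facts(5)[OF tree_imp_gtree[OF \<open>tree T\<close>]]
    by simp
  then have "edges T = edges G"
    using T(1) connected_graph_facts(2)[OF c] by (simp add: spanning_tree_def card_subset_eq)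
  then have "T = G" using T(1) by (simp add: spanning_tree_def graph.expand)
  then show ?thesis using T by simp
qed

text \<open>The star at \<open>v\<close> is a subtree with all neighbours of \<open>v\<close>
  attached as leaves.\<close>

lemma degree_le_max_leaves:
  assumes "connected_graph G" "v \<in> verts G"
  shows "degree G v \<le> max_leaves G"
proof -
  note f = connected_graph_facts[OF assms(1)]
  let ?S = "{u. {u, v} \<in> edges G}"
  have SV: "?S \<subseteq> verts G" by (intro subsetI, drule CollectD) (rule edge_ends(1)[OF f(3)])
  have vS: "v \<notin> ?S" using edge_ends(3)[OF f(3), of v v] by (metis mem_Collect_eq)
  have fin: "finite ?S" by (rule finite_subset[OF SV f(1)])
  have "{e \<in> edges G. v \<in> e} = (\<lambda>u. {u, v}) ` ?S"
  proof (intro equalityI subsetI)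
    fix e assume e: "e \<in> {e \<in> edges G. v \<in> e}"
    then have "e \<in> all_edges (verts G)" "v \<in> e" using f(3) by auto
    then obtain y where "e = {v, y}" by (rule all_edgesE)
    then show "e \<in> (\<lambda>u. {u, v}) ` ?S" using e by (auto simp: insert_commute)
  qed auto
  then have "degree G v \<le> card ?S" unfolding degree_def using card_image_le[OF fin] by simp
  also have "\<dots> \<le> num_leaves (Graph ({v} \<union> ?S) ({} \<union> (\<lambda>s. {s, (\<lambda>_. v) s}) ` ?S))"
    by (rule gtree_attach(2)) (use fin vS in \<open>auto intro: gtree.single\<close>)
  also have "\<dots> \<le> max_leaves G"
    by (rule subtree_leaves_le_max_leaves[OF assms(1) gtree_attach(1)])
       (use fin vS SV assms(2) in \<open>auto intro: gtree.single\<close>)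
  finally show ?thesis .
qed

lemma handshake:
  assumes "simple_graph G"
  shows "(\<Sum>v\<in>verts G. degree G v) = 2 * card (edges G)"
proof -
  have fin: "finite (verts G)" "finite (edges G)"
    using assms finite_subset[OF _ finite_all_edges] by (auto simp: simple_graph_def)
  have "(\<Sum>v\<in>verts G. degree G v) = (\<Sum>v\<in>verts G. \<Sum>e\<in>edges G. if v \<in> e then 1 else 0)"
    using fin by (simp add: degree_def sum.If_cases Int_def)
  also have "\<dots> = (\<Sum>e\<in>edges G. \<Sum>v\<in>verts G. if v \<in> e then 1 else 0)" by (rule sum.swap)
  also have "\<dots> = (\<Sum>e\<in>edges G. 2)"
  proof (rule sum.cong)
    fix e assume "e \<in> edges G"
    then have "e \<subseteq> verts G" "card e = 2" using assms by (auto simp: simple_graph_def all_edges_def)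
    then have "verts G \<inter> {v. v \<in> e} = e" by auto
    then show "(\<Sum>v\<in>verts G. if v \<in> e then 1 else 0) = (2::nat)"
      using fin \<open>card e = 2\<close> by (simp add: sum.If_cases)
  qed simp
  finally show ?thesis by simp
qed

text \<open>If every degree were at most 2, the degree sum would give at most as many edges as
  vertices.\<close>

lemma max_leaves_ge_3:
  assumes "connected_graph G" "card (verts G) < card (edges G)"
  shows "3 \<le> max_leaves G"
proof (rule ccontr)
  assume "\<not> 3 \<le> max_leaves G"
  then have "\<And>v. v \<in> verts G \<Longrightarrow> degree G v \<le> 2"
    using degree_le_max_leaves[OF assms(1)] by fastforce
  then have "(\<Sum>v\<in>verts G. degree G v) \<le> (\<Sum>v\<in>verts G. 2)" by (rule sum_mono)
  then show False using handshake[of G] assms by (simp add: connected_graph_def)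
qed

section \<open>The lower bound\<close>

lemma num_colors_le:
  assumes "connected_graph G"
  shows "num_colors G cv ce \<le> card (verts G) + card (edges G)"
proof -
  note f = connected_graph_facts[OF assms]
  have "num_colors G cv ce \<le> card (cv ` verts G) + card (ce ` edges G)"
    unfolding num_colors_def by (rule card_Un_le)
  also have "\<dots> \<le> card (verts G) + card (edges G)"
    by (intro add_mono card_image_le f)
  finally show ?thesis .
qed

lemma finite_color_counts:
  assumes "connected_graph G"
  shows "finite {num_colors G cv ce |cv ce. TMC_coloring G cv ce}"
  by (rule finite_subset[of _ "{..card (verts G) + card (edges G)}"])
     (auto intro: num_colors_le[OF assms])

lemma tmc_ge:
  assumes "connected_graph G" "TMC_coloring G cv ce"
  shows "num_colors G cv ce \<le> tmc G"
  unfolding tmc_def using assms by (intro Max_ge finite_color_counts) blast+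

text \<open>The block \<open>A\<close>, \<open>C\<close> shares color 0, while the other vertices
  get distinct odd colors and the other edges distinct positive even ones. The \<open>Suc\<close>
  counts color 0, which occurs because the block is nonempty.\<close>

lemma block_coloring:
  assumes "finite (verts G)" "finite (edges G)" "A \<subseteq> verts G" "C \<subseteq> edges G" "A \<noteq> {} \<or> C \<noteq> {}"
  obtains cv ce where "\<And>v. v \<in> A \<Longrightarrow> cv v = 0" "\<And>e. e \<in> C \<Longrightarrow> ce e = 0"
    "num_colors G cv ce = Suc (card (verts G - A) + card (edges G - C))"
proof -
  obtain f :: "'a \<Rightarrow> nat" where f: "inj_on f (verts G)"
    using finite_imp_inj_to_nat_seg[OF assms(1)] by blast
  obtain g :: "'a set \<Rightarrow> nat" where g: "inj_on g (edges G)"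
    using finite_imp_inj_to_nat_seg[OF assms(2)] by blast
  define cv where "cv = (\<lambda>v. if v \<in> A then 0 else 2 * f v + 1)"
  define ce where "ce = (\<lambda>e. if e \<in> C then 0 else 2 * g e + 2)"
  let ?X = "(\<lambda>v. 2 * f v + 1) ` (verts G - A)" and ?Y = "(\<lambda>e. 2 * g e + 2) ` (edges G - C)"
  have "cv ` verts G \<union> ce ` edges G = insert 0 (?X \<union> ?Y)"
    using assms(3-5) by (auto simp: cv_def ce_def image_iff)
  moreover have "?X \<inter> ?Y = {}"
  proof -
    have "odd x" if "x \<in> ?X" for x using that by auto
    moreover have "even y" if "y \<in> ?Y" for y using that by auto
    ultimately show ?thesis by blast
  qed
  moreover have "0 \<notin> ?X \<union> ?Y" by auto
  moreover have "card ?X = card (verts G - A)" "card ?Y = card (edges G - C)"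
    using f g by (auto intro!: card_image simp: inj_on_def)
  ultimately have "num_colors G cv ce = Suc (card (verts G - A) + card (edges G - C))"
    unfolding num_colors_def using assms(1,2) by (simp add: card_Un_disjoint)
  then show ?thesis using that[of cv ce] by (simp add: cv_def ce_def)
qed

lemma internal_vertsE:
  assumes "w \<in> internal_verts p"
  obtains i where "w = p ! Suc i" "Suc (Suc i) < length p"
proof -
  obtain j where "j < length (butlast (tl p))" "butlast (tl p) ! j = w"
    using assms by (auto simp: internal_verts_def in_set_conv_nth)
  then show ?thesis using that[of j] by (simp add: nth_butlast nth_tl)
qed

text \<open>An internal vertex lies on two different edges of the path. Hence the leaves of a tree
  are never internal and are free to have colors of their own.\<close>

lemma internal_degree:
  assumes "is_path T p" "finite (edges T)" "w \<in> internal_verts p"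
  shows "degree T w \<noteq> 1"
proof -
  obtain i where i: "w = p ! Suc i" "Suc (Suc i) < length p" using assms(3) by (rule internal_vertsE)
  have d: "distinct p" using assms(1) by (simp add: is_path_def)
  have E: "{p ! i, p ! Suc i} \<in> edges T" "{p ! Suc i, p ! Suc (Suc i)} \<in> edges T"
    using assms(1) i(2) by (simp_all add: is_path_def)
  have ne: "{p ! i, p ! Suc i} \<noteq> {p ! Suc i, p ! Suc (Suc i)}"
    using d i(2) by (simp add: doubleton_eq_iff nth_eq_iff_index_eq)
  have "card {{p ! i, p ! Suc i}, {p ! Suc i, p ! Suc (Suc i)}} \<le> degree T w"
    unfolding degree_def using E i(1) assms(2) by (intro card_mono) auto
  then show ?thesis using ne by simp
qed

text \<open>One color is used for the edges and non-leaves of an optimal spanning tree, whose paths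
  then connect everything. The \<open>l\<close> leaves and the \<open>m - (n - 1)\<close> remaining
  edges add their own colors. The additive form avoids truncated subtraction.\<close>

lemma tmc_lower_bound:
  assumes "connected_graph G"
  shows "card (edges G) + 2 + max_leaves G \<le> tmc G + card (verts G)"
proof -
  note f = connected_graph_facts[OF assms]
  obtain T where T: "spanning_tree T G" "num_leaves T = max_leaves G"
    using max_leaves_attained[OF assms] .
  then have T': "tree T" "verts T = verts G" "edges T \<subseteq> edges G" by (simp_all add: spanning_tree_def)
  have cT: "connected_graph T" using T'(1) by (simp add: tree_def)
  have nT: "card (verts G) = Suc (card (edges T))"
    using gtree_facts(5)[OF tree_imp_gtree[OF T'(1)]] T'(2) by simp
  have finT: "finite (edges T)" using T'(3) f(2) finite_subset by blast
  \<comment> \<open>The condition is not "at least 2": in a one-vertex tree the vertex has degree 0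
    and must be in the block to keep it nonempty.\<close>
  let ?A = "{v \<in> verts G. degree T v \<noteq> 1}"
  have ne: "?A \<noteq> {} \<or> edges T \<noteq> {}"
    using f(4) by (cases "edges T = {}") (auto simp: degree_def)
  obtain cv ce where c: "\<And>v. v \<in> ?A \<Longrightarrow> cv v = 0" "\<And>e. e \<in> edges T \<Longrightarrow> ce e = 0"
    "num_colors G cv ce = Suc (card (verts G - ?A) + card (edges G - edges T))"
    using block_coloring[OF f(1,2) _ T'(3) ne] by blast
  have "TMC_coloring G cv ce"
    unfolding TMC_coloring_def
  proof (intro ballI impI)
    fix u v assume "u \<in> verts G" "v \<in> verts G" "u \<noteq> v"
    then obtain p where p: "path_between T u p v" using connected_graphD[OF cT] T'(2) by blast
    then have pT: "is_path T p" by (simp add: path_between_def)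
    have "path_between G u p v"
      using p is_path_mono[OF pT, of G] T' by (simp add: path_between_def)
    moreover have "\<forall>e\<in>path_edges p. ce e = 0"
      using pT c(2) by (auto simp: path_edges_def is_path_def)
    moreover have "\<forall>w\<in>internal_verts p. cv w = 0"
    proof
      fix w assume w: "w \<in> internal_verts p"
      then have "w \<in> set p" by (auto elim!: internal_vertsE)
      then have "w \<in> verts G" using pT T'(2) by (auto simp: is_path_def)
      then show "cv w = 0" using internal_degree[OF pT finT w] c(1) by simp
    qed
    ultimately show "\<exists>p. path_between G u p v \<and> total_mono_path cv ce p"
      unfolding total_mono_path_def by blast
  qed
  then have "num_colors G cv ce \<le> tmc G" by (rule tmc_ge[OF assms])
  moreover have "card (verts G - ?A) = max_leaves G"
  proof -
    have "verts G - ?A = {v \<in> verts T. degree T v = 1}" using T'(2) by auto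
    then show ?thesis using T(2) by (simp add: num_leaves_def)
  qed
  moreover have "card (edges G - edges T) = card (edges G) - card (edges T)"
    using finT T'(3) by (rule card_Diff_subset)
  moreover have "card (edges T) \<le> card (edges G)" using f(2) T'(3) by (rule card_mono)
  ultimately show ?thesis using c(3) nT by linarith
qed

lemma tmc_le:
  assumes "connected_graph G" "\<And>cv ce. TMC_coloring G cv ce \<Longrightarrow> num_colors G cv ce \<le> b"
  shows "tmc G \<le> b"
proof -
  \<comment> \<open>The constant coloring shows that \<open>Max\<close> ranges over a nonempty set,
    so the maximum is attained.\<close>
  have "TMC_coloring G (\<lambda>_. 0) (\<lambda>_. 0)"
    using connected_graphD[OF assms(1)]
    unfolding TMC_coloring_def total_mono_path_def by (metis (no_types))
  then have "{num_colors G cv ce |cv ce. TMC_coloring G cv ce} \<noteq> {}" by blast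
  from Max_in[OF finite_color_counts[OF assms(1)] this]
  have "tmc G \<in> {num_colors G cv ce |cv ce. TMC_coloring G cv ce}" by (simp only: tmc_def)
  then show ?thesis using assms(2) by auto
qed

section \<open>Monochromatic pieces\<close>

locale colored_graph =
  fixes G :: "'a graph" and cv :: "'a \<Rightarrow> nat" and ce :: "'a set \<Rightarrow> nat"
  assumes connected: "connected_graph G"
begin

text \<open>These are the steps between consecutive internal vertices of a total monochromatic path.
  The internal vertices of such a path therefore stay in one class of the closure, which is a
  piece.\<close>

definition mono_rel :: "('a \<times> 'a) set" where
  "mono_rel = {(x, y). {x, y} \<in> edges G \<and> cv x = ce {x, y} \<and> cv y = ce {x, y}}"

definition piece :: "'a \<Rightarrow> 'a set" where
  "piece x = mono_rel\<^sup>* `` {x}"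

definition pieces :: "'a set set" where
  "pieces = piece ` verts G"

definition piece_edges :: "'a set \<Rightarrow> 'a set set" where
  "piece_edges D = {e \<in> edges G. \<exists>x\<in>D. x \<in> e \<and> ce e = cv x}"

text \<open>The ends of a total monochromatic path may have any color. So a path running inside
  \<open>D\<close> can still end at the far end of any edge in \<open>piece_edges D\<close>, and the
  hull collects all vertices reached in this way.\<close>

definition hull :: "'a set \<Rightarrow> 'a set" where
  "hull D = D \<union> \<Union>(piece_edges D)"

lemmas graph_facts = connected_graph_facts[OF connected]

lemma sym_mono_rel: "sym (mono_rel\<^sup>*)"
  by (rule sym_rtrancl) (auto simp: sym_def mono_rel_def insert_commute)

lemma piece_self: "x \<in> piece x"
  by (simp add: piece_def)

lemma piece_eq: "y \<in> piece x \<Longrightarrow> piece y = piece x"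
  using sym_mono_rel unfolding piece_def sym_def by (auto intro: rtrancl_trans)

lemma piece_color:
  assumes "y \<in> piece x"
  shows "cv y = cv x"
proof -
  have "(x, y) \<in> mono_rel\<^sup>*" using assms by (simp add: piece_def)
  then show ?thesis by (induction rule: rtrancl_induct) (auto simp: mono_rel_def)
qed

lemma piece_subset:
  assumes "x \<in> verts G"
  shows "piece x \<subseteq> verts G"
proof
  fix y assume "y \<in> piece x"
  then have "(x, y) \<in> mono_rel\<^sup>*" by (simp add: piece_def)
  then show "y \<in> verts G"
    using assms edge_ends[OF graph_facts(3)]
    by (induction rule: rtrancl_induct) (auto simp: mono_rel_def)
qed

lemma pieces_eq_piece:
  assumes "D \<in> pieces" "x \<in> D"
  shows "D = piece x"
  using assms piece_eq by (auto simp: pieces_def)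

lemma pieces_disjoint: "D \<in> pieces \<Longrightarrow> D' \<in> pieces \<Longrightarrow> x \<in> D \<Longrightarrow> x \<in> D' \<Longrightarrow> D = D'"
  using pieces_eq_piece by blast

lemma finite_pieces: "finite pieces"
  using graph_facts(1) by (simp add: pieces_def)

lemma piece_in_pieces: "x \<in> verts G \<Longrightarrow> piece x \<in> pieces"
  by (simp add: pieces_def)

lemma pieces_nonempty: "D \<in> pieces \<Longrightarrow> D \<noteq> {}"
  using piece_self by (auto simp: pieces_def)

lemma pieces_subset: "D \<in> pieces \<Longrightarrow> D \<subseteq> verts G"
  using piece_subset by (auto simp: pieces_def)

text \<open>If an edge has the color of both of its ends, then \<open>mono_rel\<close> relates them
  and they share a piece; otherwise the edge belongs to at most one end's piece.\<close>

lemma piece_edges_disjoint: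
  assumes "D \<in> pieces" "D' \<in> pieces" "e \<in> piece_edges D" "e \<in> piece_edges D'"
  shows "D = D'"
proof -
  obtain x where x: "x \<in> D" "x \<in> e" "ce e = cv x" "e \<in> edges G"
    using assms(3) by (auto simp: piece_edges_def)
  obtain y where y: "y \<in> D'" "y \<in> e" "ce e = cv y" using assms(4) by (auto simp: piece_edges_def)
  have "e \<in> all_edges (verts G)" using x(4) graph_facts(3) by blast
  then obtain z where z: "e = {x, z}" using x(2) by (rule all_edgesE)
  show ?thesis
  proof (cases "x = y")
    case True
    then show ?thesis using pieces_disjoint[OF assms(1,2)] x y by blast
  next
    case False
    then have e: "e = {x, y}" using y(2) z by blast
    then have "(x, y) \<in> mono_rel" using x y by (simp add: mono_rel_def)
    then have "y \<in> D" using pieces_eq_piece[OF assms(1) x(1)] by (auto simp: piece_def)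
    then show ?thesis using pieces_disjoint[OF assms(1,2)] y(1) by blast
  qed
qed

section \<open>Counting colors piece by piece\<close>

lemma card_verts_pieces: "card (verts G) = (\<Sum>D\<in>pieces. card D)"
proof -
  have "\<Union>pieces = verts G" using piece_self piece_subset by (auto simp: pieces_def)
  moreover have "card (\<Union>pieces) = (\<Sum>D\<in>pieces. card D)"
  proof (rule card_Union_disjoint)
    show "pairwise disjnt pieces"
      using pieces_disjoint unfolding pairwise_def disjnt_def by blast
    show "finite D" if "D \<in> pieces" for D
      using finite_subset[OF pieces_subset[OF that] graph_facts(1)] .
  qed
  ultimately show ?thesis by simp
qed

lemma finite_piece_edges: "finite (piece_edges D)"
  using graph_facts(2) by (simp add: piece_edges_def)

lemma card_piece_edges_Union: "card (\<Union>(piece_edges ` pieces)) = (\<Sum>D\<in>pieces. card (piece_edges D))"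
  by (rule card_UN_disjoint) (use finite_pieces finite_piece_edges piece_edges_disjoint in blast)+

lemma sum_piece_edges_le: "(\<Sum>D\<in>pieces. card (piece_edges D)) \<le> card (edges G)"
  unfolding card_piece_edges_Union[symmetric]
  by (rule card_mono[OF graph_facts(2)]) (auto simp: piece_edges_def)

text \<open>The weight of a piece is the number of colors it loses.\<close>

definition weight :: "'a set \<Rightarrow> nat" where
  "weight D = card (piece_edges D) + card D - 1"

text \<open>The vertices show at most one color per piece, the piece edges only repeat vertex
  colors, and every other edge adds at most one color. Writing the number of vertices as the sum of
  the piece sizes turns this into a bound by weights.\<close>

lemma num_colors_weight: "num_colors G cv ce + (\<Sum>D\<in>pieces. weight D) \<le> card (verts G) + card (edges G)"
proof -
  let ?F = "\<Union>(piece_edges ` pieces)"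
  have FE: "?F \<subseteq> edges G" by (auto simp: piece_edges_def)
  have "cv ` verts G \<union> ce ` edges G \<subseteq> cv ` verts G \<union> ce ` (edges G - ?F)"
  proof -
    have "ce e \<in> cv ` verts G" if "e \<in> ?F" for e
      using that pieces_subset by (auto simp: piece_edges_def)
    then show ?thesis by blast
  qed
  then have "num_colors G cv ce \<le> card (cv ` verts G \<union> ce ` (edges G - ?F))"
    unfolding num_colors_def using graph_facts by (intro card_mono) auto
  also have "\<dots> \<le> card (cv ` verts G) + card (ce ` (edges G - ?F))" by (rule card_Un_le)
  also have "card (cv ` verts G) \<le> card pieces"
  \<comment> \<open>A piece has a single color, so the color of a chosen representative maps the
    pieces onto all vertex colors.\<close>
  proof (rule surj_card_le[OF finite_pieces, where f = "\<lambda>D. cv (SOME x. x \<in> D)"], rule subsetI)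
    fix c assume "c \<in> cv ` verts G"
    then obtain x where x: "x \<in> verts G" "c = cv x" by blast
    have "(SOME y. y \<in> piece x) \<in> piece x" using piece_self by (rule someI)
    then have "c = cv (SOME y. y \<in> piece x)" using piece_color x(2) by simp
    then show "c \<in> (\<lambda>D. cv (SOME x. x \<in> D)) ` pieces" using piece_in_pieces[OF x(1)] by blast
  qed
  also have "card (ce ` (edges G - ?F)) \<le> card (edges G - ?F)"
    using graph_facts(2) by (intro card_image_le) simp
  also have "card (edges G - ?F) = card (edges G) - (\<Sum>D\<in>pieces. card (piece_edges D))"
    using FE finite_subset[OF FE graph_facts(2)] card_piece_edges_Union by (simp add: card_Diff_subset)
  finally have q: "num_colors G cv ce + (\<Sum>D\<in>pieces. card (piece_edges D)) \<le> card pieces + card (edges G)"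
    using sum_piece_edges_le by linarith
  have "(\<Sum>D\<in>pieces. weight D) + card pieces = (\<Sum>D\<in>pieces. weight D + 1)"
    by (simp only: sum.distrib) simp
  \<comment> \<open>Pieces are nonempty, so the subtraction in \<open>weight\<close> is not
    truncated.\<close>
  also have "\<dots> = (\<Sum>D\<in>pieces. card (piece_edges D) + card D)"
  proof (rule sum.cong[OF refl])
    fix D assume D: "D \<in> pieces"
    then have "card D \<noteq> 0"
      using pieces_nonempty finite_subset[OF pieces_subset graph_facts(1)] by simp
    then show "weight D + 1 = card (piece_edges D) + card D" by (simp add: weight_def)
  qed
  also have "\<dots> = (\<Sum>D\<in>pieces. card (piece_edges D)) + card (verts G)"
    by (simp add: sum.distrib card_verts_pieces)
  finally show ?thesis using q by linarith
qed

section \<open>Hulls and widths of pieces\<close>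

lemma hull_subset: "D \<in> pieces \<Longrightarrow> hull D \<subseteq> verts G"
  using pieces_subset graph_facts(3) by (fastforce simp: hull_def piece_edges_def all_edges_def)

lemma piece_edges_subset: "piece_edges D \<subseteq> all_edges (hull D)"
  using graph_facts(3) by (fastforce simp: hull_def piece_edges_def all_edges_def)

text \<open>The piece is connected by \<open>mono_rel\<close>, hence spanned by a tree of its own
  edges. Each vertex of the hull outside the piece is joined to it by a piece edge and can be hung
  on as a leaf.\<close>

lemma hull_tree:
  assumes "D \<in> pieces"
  obtains E where "gtree (hull D) E" "E \<subseteq> piece_edges D" "card (hull D - D) \<le> num_leaves (Graph (hull D) E)"
proof -
  obtain x where x: "x \<in> verts G" "D = piece x" using assms by (auto simp: pieces_def)
  have finD: "finite D" using finite_subset[OF pieces_subset[OF assms] graph_facts(1)] .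
  have finH: "finite (hull D)" using finite_subset[OF hull_subset[OF assms] graph_facts(1)] .
  have cl: "mono_rel `` D \<subseteq> D" using x(2) by (auto simp: piece_def intro: rtrancl_into_rtrancl)
  have "\<exists>E. gtree D E \<and> E \<subseteq> {} \<union> {{b, a} |a b. (a, b) \<in> mono_rel \<and> a \<in> D} \<and>
      num_leaves (Graph {x} {}) \<le> num_leaves (Graph D E)"
    by (rule gtree_extend[OF gtree.single]) (use x piece_self finD cl in \<open>auto simp: piece_def\<close>)
  then obtain E where E: "gtree D E" "E \<subseteq> {{b, a} |a b. (a, b) \<in> mono_rel \<and> a \<in> D}" by auto
  have EF: "E \<subseteq> piece_edges D"
    using E(2) by (fastforce simp: mono_rel_def piece_edges_def insert_commute)
  have "\<exists>y\<in>D. {s, y} \<in> piece_edges D" if s: "s \<in> hull D - D" for s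
  proof -
    obtain e where e: "e \<in> piece_edges D" "s \<in> e" using s by (auto simp: hull_def)
    then obtain y where y: "y \<in> D" "y \<in> e" by (auto simp: piece_edges_def)
    have "e \<in> all_edges (hull D)" using e(1) piece_edges_subset by blast
    then obtain z where "e = {s, z}" using e(2) by (rule all_edgesE)
    then have "e = {s, y}" using y s by blast
    then show ?thesis using y(1) e(1) by blast
  qed
  then obtain f where f: "\<And>s. s \<in> hull D - D \<Longrightarrow> f s \<in> D \<and> {s, f s} \<in> piece_edges D" by metis
  let ?E = "E \<union> (\<lambda>s. {s, f s}) ` (hull D - D)"
  have HD: "D \<union> (hull D - D) = hull D" by (auto simp: hull_def)
  have att: "gtree (D \<union> (hull D - D)) ?E" "card (hull D - D) \<le> num_leaves (Graph (D \<union> (hull D - D)) ?E)"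
    by (rule gtree_attach[OF E(1)]; use finH f in auto)+
  have "?E \<subseteq> piece_edges D" using EF f by blast
  then show ?thesis using that[of ?E] att unfolding HD by blast
qed

text \<open>The number of edges in a spanning tree of the hull; it measures the cost of a piece as
  well as the number of pairs it can join.\<close>

definition width :: "'a set \<Rightarrow> nat" where
  "width D = card (hull D) - 1"

text \<open>With \<open>a\<close> for the width, the hull tree gives at least \<open>a\<close> piece
  edges. Its \<open>a + 1 - card D\<close> outer leaves number at most \<open>max_leaves G\<close>,
  so \<open>card D\<close> is at least \<open>a + 1 - max_leaves G\<close>. Adding the two bounds
  yields the last claim.\<close>

lemma piece_bounds:
  assumes "D \<in> pieces"
  shows "width D \<le> card (piece_edges D)" "card (hull D) = Suc (width D)"
    "width D \<le> weight D" "2 * width D \<le> weight D + max_leaves G"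
proof -
  obtain E where E: "gtree (hull D) E" "E \<subseteq> piece_edges D"
      "card (hull D - D) \<le> num_leaves (Graph (hull D) E)"
    using hull_tree[OF assms] .
  have finD: "finite D" using finite_subset[OF pieces_subset[OF assms] graph_facts(1)] .
  then have D0: "card D \<noteq> 0" using pieces_nonempty[OF assms] by simp
  have "card E \<le> card (piece_edges D)" using finite_piece_edges E(2) by (rule card_mono)
  then show 1: "width D \<le> card (piece_edges D)" and 2: "card (hull D) = Suc (width D)"
    using gtree_facts(5)[OF E(1)] by (simp_all add: width_def)
  show "width D \<le> weight D" using 1 D0 by (simp add: weight_def)
  have "E \<subseteq> edges G" using E(2) by (auto simp: piece_edges_def)
  then have "card (hull D - D) \<le> max_leaves G"
    using subtree_leaves_le_max_leaves[OF connected E(1) hull_subset[OF assms]] E(3) by linarith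
  moreover have "card (hull D - D) = card (hull D) - card D"
    using finD by (intro card_Diff_subset) (auto simp: hull_def)
  ultimately show "2 * width D \<le> weight D + max_leaves G"
    using 1 2 D0 by (simp add: weight_def)
qed

text \<open>A monochromatic path between non-adjacent vertices has an internal vertex. All internal
  vertices lie in one piece, and the first and last edges are piece edges, so both ends lie in its
  hull.\<close>

lemma nonadjacent_in_hull:
  assumes "TMC_coloring G cv ce" "u \<in> verts G" "v \<in> verts G" "u \<noteq> v" "{u, v} \<notin> edges G"
  obtains D where "D \<in> pieces" "{u, v} \<subseteq> hull D"
proof -
  obtain p where p: "path_between G u p v" "total_mono_path cv ce p"
    using assms unfolding TMC_coloring_def by blast
  obtain k where k: "\<forall>e\<in>path_edges p. ce e = k" "\<forall>w\<in>internal_verts p. cv w = k"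
    using p(2) by (auto simp: total_mono_path_def)
  have pp: "p \<noteq> []" "hd p = u" "last p = v" "set p \<subseteq> verts G"
    and pE: "\<And>i. Suc i < length p \<Longrightarrow> {p ! i, p ! Suc i} \<in> edges G"
    using p(1) by (simp_all add: path_between_def is_path_def)
  have u: "p ! 0 = u" and v: "p ! (length p - 1) = v"
    using hd_conv_nth[OF pp(1)] last_conv_nth[OF pp(1)] pp(2,3) by simp_all
  have "length p \<noteq> 1" using u v assms(4) by auto
  moreover have "length p \<noteq> 2" using pE[of 0] assms(5) u v by auto
  moreover have "length p \<noteq> 0" using pp(1) by simp
  ultimately have len: "3 \<le> length p" by linarith
  have ck: "ce {p ! i, p ! Suc i} = k" if "Suc i < length p" for i
    using k(1) that by (auto simp: path_edges_def)
  have vk: "cv (p ! i) = k" if i: "0 < i" "Suc i < length p" for i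
  proof -
    have "i - 1 < length (butlast (tl p))" using i by simp
    moreover have "butlast (tl p) ! (i - 1) = p ! i" using i by (simp add: nth_butlast nth_tl)
    ultimately have "p ! i \<in> internal_verts p" unfolding internal_verts_def by (metis nth_mem)
    then show ?thesis using k(2) by blast
  qed
  let ?D = "piece (p ! 1)"
  have D: "?D \<in> pieces" using pp(4) len by (intro piece_in_pieces) (simp add: subset_iff)
  \<comment> \<open>From the first to the last internal vertex; the two coincide when the path has
    three vertices.\<close>
  have "(p ! 1, p ! (length p - 2)) \<in> mono_rel\<^sup>*"
  proof (rule path_rtrancl)
    fix i assume "1 \<le> i" "i < length p - 2"
    then show "(p ! i, p ! Suc i) \<in> mono_rel"
      using pE[of i] ck[of i] vk[of i] vk[of "Suc i"] by (simp add: mono_rel_def)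
  qed (use len in simp)
  then have last: "p ! (length p - 2) \<in> ?D" by (simp add: piece_def)
  have S: "Suc (length p - 2) = length p - 1" using len by simp
  have "{p ! 0, p ! 1} \<in> piece_edges ?D"
    using pE[of 0] ck[of 0] vk[of 1] len piece_self[of "p ! 1"] by (auto simp: piece_edges_def)
  then have "u \<in> hull ?D" using u by (auto simp: hull_def)
  moreover have "{p ! (length p - 2), p ! (length p - 1)} \<in> piece_edges ?D"
    using pE[of "length p - 2"] ck[of "length p - 2"] vk[of "length p - 2"] len last S
    by (auto simp: piece_edges_def)
  then have "v \<in> hull ?D" using v by (auto simp: hull_def)
  ultimately show ?thesis using that[OF D] by blast
qed

text \<open>A hull of width \<open>a\<close> contains \<open>a + 1 choose 2\<close> pairs, at least
  \<open>a\<close> of which are edges, so it accounts for at most \<open>a choose 2\<close>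
  non-adjacent pairs. Everything is doubled to avoid binomial coefficients.\<close>

lemma cover_count:
  assumes "TMC_coloring G cv ce"
  shows "card (verts G) * (card (verts G) - 1) \<le> 2 * card (edges G) + (\<Sum>D\<in>pieces. width D * (width D - 1))"
proof -
  have "all_edges (verts G) - edges G \<subseteq> (\<Union>D\<in>pieces. all_edges (hull D) - piece_edges D)"
  proof
    fix e assume e: "e \<in> all_edges (verts G) - edges G"
    then obtain u v where uv: "e = {u, v}" "u \<noteq> v" "u \<in> verts G" "v \<in> verts G"
      by (auto simp: all_edges_def card_2_iff)
    have ne: "{u, v} \<notin> edges G" using e uv(1) by blast
    obtain D where D: "D \<in> pieces" "{u, v} \<subseteq> hull D"
      using nonadjacent_in_hull[OF assms uv(3,4,2) ne] .
    have "e \<in> all_edges (hull D)" using D(2) uv by (simp add: doubleton_in_all_edges)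
    moreover have "e \<notin> piece_edges D" using e by (simp add: piece_edges_def)
    ultimately show "e \<in> (\<Union>D\<in>pieces. all_edges (hull D) - piece_edges D)" using D(1) by blast
  qed
  moreover have finH: "finite (hull D)" if "D \<in> pieces" for D
    using finite_subset[OF hull_subset[OF that] graph_facts(1)] .
  ultimately have "card (all_edges (verts G) - edges G) \<le> card (\<Union>D\<in>pieces. all_edges (hull D) - piece_edges D)"
    using finite_pieces by (intro card_mono) (auto intro: finite_all_edges)
  also have "\<dots> \<le> (\<Sum>D\<in>pieces. card (all_edges (hull D) - piece_edges D))"
    using finite_pieces by (rule card_UN_le)
  also have "\<dots> \<le> (\<Sum>D\<in>pieces. width D choose 2)"
  proof (rule sum_mono)
    fix D assume D: "D \<in> pieces"
    have "card (all_edges (hull D) - piece_edges D) = (card (hull D) choose 2) - card (piece_edges D)"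
      using finite_piece_edges piece_edges_subset card_all_edges[OF finH[OF D]]
      by (simp add: card_Diff_subset)
    also have "\<dots> \<le> (Suc (width D) choose 2) - width D" using piece_bounds(1,2)[OF D] by simp
    also have "\<dots> = width D choose 2" by (simp add: numeral_2_eq_2)
    finally show "card (all_edges (hull D) - piece_edges D) \<le> width D choose 2" .
  qed
  finally have "(card (verts G) choose 2) \<le> card (edges G) + (\<Sum>D\<in>pieces. width D choose 2)"
    using graph_facts by (simp add: card_Diff_subset card_all_edges)
  then have "2 * (card (verts G) choose 2) \<le> 2 * card (edges G) + (\<Sum>D\<in>pieces. 2 * (width D choose 2))"
    by (simp add: sum_distrib_left[symmetric])
  moreover have "2 * (n choose 2) = n * (n - 1)" for n :: nat
    by (cases n) (simp_all add: choose_two)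
  ultimately show ?thesis by simp
qed

text \<open>By \<open>num_colors_weight\<close> it suffices that the pieces lose at least
  \<open>2 * N - max_leaves G\<close> colors in total, where \<open>N\<close> is the number of
  vertices minus 1. One spanning hull, or a hull missing one vertex together with a second piece of
  width at least 2, achieves this; counting pairs excludes everything else.\<close>

lemma num_colors_upper_bound:
  assumes tmc: "TMC_coloring G cv ce"
    and sparse: "card (edges G) \<le> card (verts G) + 1" "card (edges G) + 4 \<le> 2 * card (verts G)"
  shows "num_colors G cv ce + card (verts G) \<le> card (edges G) + 2 + max_leaves G"
proof -
  define m where "m = card (edges G)"
  obtain N where N: "card (verts G) = Suc N" using graph_facts(1,4) by (metis card_eq_0_iff not0_implies_Suc)
  have sp: "m \<le> N + 2" "m + 2 \<le> 2 * N" using sparse N by (simp_all add: m_def)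
  have cov: "Suc N * N \<le> 2 * m + (\<Sum>D\<in>pieces. width D * (width D - 1))"
    using cover_count[OF tmc] N by (simp add: m_def)
  have widths: "(\<Sum>D\<in>pieces. width D) \<le> m"
    unfolding m_def using sum_piece_edges_le piece_bounds(1)
    by (meson le_trans sum_mono)
  have "2 * N \<le> (\<Sum>D\<in>pieces. weight D) + max_leaves G"
  proof (cases "\<exists>D\<in>pieces. N \<le> width D")
    case True
    then obtain D where D: "D \<in> pieces" "N \<le> width D" by blast
    then have "weight D \<le> (\<Sum>D\<in>pieces. weight D)" using finite_pieces by (intro member_le_sum) auto
    then show ?thesis using piece_bounds(4)[OF D(1)] D(2) by linarith
  next
    case False
    then have small: "\<And>D. D \<in> pieces \<Longrightarrow> width D < N" by force
    have "\<exists>D\<in>pieces. width D = N - 1"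
    proof (rule ccontr)
      assume "\<not> ?thesis"
      then have "width D \<le> N - 2" if "D \<in> pieces" for D using small[OF that] that by fastforce
      \<comment> \<open>If all widths are at most \<open>N - 2\<close>, then
        \<open>N * (N + 1)\<close> is at most \<open>m * (N - 1)\<close>, hence at most
        \<open>(N + 2) * (N - 1)\<close>, which is smaller by 2. Values of \<open>N\<close> below 3
        are treated separately because \<open>N - 3\<close> is truncated.\<close>
      then have "(\<Sum>D\<in>pieces. width D * (width D - 1)) \<le> (\<Sum>D\<in>pieces. width D * (N - 3))"
        by (intro sum_mono mult_le_mono2) (metis diff_diff_left diff_le_mono numeral_2_eq_2 numeral_3_eq_3 plus_1_eq_Suc add.commute Suc_1)
      also have "\<dots> \<le> m * (N - 3)" using widths by (simp add: sum_distrib_right[symmetric])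
      finally have c: "Suc N * N \<le> 2 * m + m * (N - 3)" using cov by linarith
      show False
      proof (cases "3 \<le> N")
        case True
        then obtain j where j: "N = j + 3" by (metis add.commute le_Suc_ex)
        have "m * (j + 2) \<le> (j + 5) * (j + 2)" using sp(1) j by (intro mult_le_mono1) simp
        then show False using c j by (simp add: algebra_simps)
      next
        case False
        then have "N = 0 \<or> N = 1 \<or> N = 2" by linarith
        then show False using c sp by auto
      qed
    qed
    then obtain D where D: "D \<in> pieces" "width D = N - 1" by blast
    let ?R = "pieces - {D}"
    have "\<exists>D'\<in>?R. 2 \<le> width D'"
    proof (rule ccontr)
      assume "\<not> ?thesis"
      \<comment> \<open>Widths 0 and 1 join no non-adjacent pair. The piece \<open>D\<close> alone
        would force \<open>m\<close> to be at least \<open>2 * N - 1\<close>, against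
        \<open>m + 2 \<le> 2 * N\<close>.\<close>
      then have "width D' * (width D' - 1) = 0" if "D' \<in> ?R" for D'
        using that by (metis diff_is_0_eq less_2_cases mult_is_0 not_le One_nat_def order_refl)
      then have "(\<Sum>D\<in>?R. width D * (width D - 1)) = 0" by (intro sum.neutral ballI)
      then have "(\<Sum>D\<in>pieces. width D * (width D - 1)) = (N - 1) * (N - 1 - 1)"
        using sum.remove[OF finite_pieces D(1), of "\<lambda>D. width D * (width D - 1)"] D(2) by simp
      then have c: "Suc N * N \<le> 2 * m + (N - 1) * (N - 1 - 1)" using cov by simp
      have "N \<noteq> 1" using c sp(2) by auto
      then have "2 \<le> N" using sp(2) by linarith
      then obtain j where "N = j + 2" by (metis add.commute le_Suc_ex)
      then show False using c sp(2) by (simp add: algebra_simps)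
    qed
    then obtain D' where D': "D' \<in> pieces" "D' \<noteq> D" "2 \<le> width D'" by blast
    have "weight D + weight D' = (\<Sum>D\<in>{D, D'}. weight D)" using D'(2) by simp
    also have "\<dots> \<le> (\<Sum>D\<in>pieces. weight D)"
      using finite_pieces D(1) D'(1) by (intro sum_mono2) auto
    finally show ?thesis
      using piece_bounds(4)[OF D(1)] piece_bounds(3)[OF D'(1)] D(2) D'(3) by linarith
  qed
  then show ?thesis using num_colors_weight N by linarith
qed

end

text \<open>The hypotheses cover trees from 3 vertices on, unicyclic graphs from 4 and bicyclic
  graphs from 5.\<close>

lemma tmc_sparse:
  assumes "connected_graph G" "card (edges G) \<le> card (verts G) + 1" "card (edges G) + 4 \<le> 2 * card (verts G)"
  shows "tmc G + card (verts G) = card (edges G) + 2 + max_leaves G"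
proof -
  have "tmc G \<le> card (edges G) + 2 + max_leaves G - card (verts G)"
  proof (rule tmc_le[OF assms(1)])
    fix cv ce assume "TMC_coloring G cv ce"
    then have "num_colors G cv ce + card (verts G) \<le> card (edges G) + 2 + max_leaves G"
      using assms by (intro colored_graph.num_colors_upper_bound colored_graph.intro)
    then show "num_colors G cv ce \<le> card (edges G) + 2 + max_leaves G - card (verts G)" by linarith
  qed
  then show ?thesis using tmc_lower_bound[OF assms(1)] connected_card_edges(1)[OF assms(1)] by linarith
qed

section \<open>The exceptional graphs\<close>

lemma edge_mono_path:
  assumes "simple_graph G" "{u, v} \<in> edges G"
  shows "path_between G u [u, v] v" "total_mono_path cv ce [u, v]"
proof -
  have "u \<in> verts G" "v \<in> verts G" "u \<noteq> v"
    using edge_ends[of G u v] assms by (simp_all add: simple_graph_def)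
  then show "path_between G u [u, v] v"
    using assms(2) by (simp add: path_between_def is_path_def)
  show "total_mono_path cv ce [u, v]"
    by (auto simp: total_mono_path_def path_edges_def internal_verts_def)
qed

text \<open>All pairs are adjacent and a single edge is always monochromatic, so all six vertices
  and edges may have different colors.\<close>

lemma tmc_triangle:
  assumes "connected_graph G" "card (verts G) = 3" "card (edges G) = 3"
  shows "tmc G = 6"
proof -
  note f = connected_graph_facts[OF assms(1)]
  have E: "edges G = all_edges (verts G)"
    using f assms(2,3) by (intro card_subset_eq) (simp_all add: finite_all_edges card_all_edges numeral_3_eq_3 numeral_2_eq_2)
  have sG: "simple_graph G" using assms(1) by (simp add: connected_graph_def)
  obtain x where x: "x \<in> verts G" using f(4) by blast
  \<comment> \<open>A block consisting of one vertex makes the coloring injective on vertices and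
    edges together.\<close>
  obtain cv ce where c: "\<And>v. v \<in> {x} \<Longrightarrow> cv v = 0" "\<And>e. e \<in> {} \<Longrightarrow> ce e = 0"
    "num_colors G cv ce = Suc (card (verts G - {x}) + card (edges G - {}))"
    by (rule block_coloring[OF f(1,2), of "{x}" "{}"]) (use x in simp_all)
  have "TMC_coloring G cv ce"
    unfolding TMC_coloring_def
  proof (intro ballI impI)
    fix a b assume "a \<in> verts G" "b \<in> verts G" "a \<noteq> b"
    then have "{a, b} \<in> edges G" using E by (simp add: doubleton_in_all_edges)
    then show "\<exists>p. path_between G a p b \<and> total_mono_path cv ce p"
      using edge_mono_path[OF sG] by blast
  qed
  then have "6 \<le> tmc G" using tmc_ge[OF assms(1), of cv ce] c(3) assms(2,3) x f(1) by simp
  moreover have "tmc G \<le> card (verts G) + card (edges G)"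
    by (rule tmc_le[OF assms(1) num_colors_le[OF assms(1)]])
  ultimately show ?thesis using assms(2,3) by simp
qed

lemma diamond_edges:
  assumes "connected_graph G" "card (verts G) = 4" "card (edges G) = 5"
  obtains x y u v where "verts G = {x, y, u, v}" "distinct [x, y, u, v]"
    "edges G = all_edges (verts G) - {{x, y}}"
proof -
  note f = connected_graph_facts[OF assms(1)]
  have "card (all_edges (verts G) - edges G) = 1"
    using f assms(2,3) by (simp add: card_Diff_subset card_all_edges choose_two)
  then obtain e where e: "all_edges (verts G) - edges G = {e}" by (auto simp: card_1_singleton_iff)
  then have "e \<in> all_edges (verts G)" by blast
  then obtain x y where xy: "e = {x, y}" "x \<noteq> y" "x \<in> verts G" "y \<in> verts G"
    by (auto simp: all_edges_def card_2_iff)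
  have "card (verts G - {x, y}) = 2" using assms(2) xy f(1) by (simp add: card_Diff_subset)
  then obtain u v where uv: "verts G - {x, y} = {u, v}" "u \<noteq> v" by (auto simp: card_2_iff)
  have "verts G = {x, y, u, v}" "distinct [x, y, u, v]" using uv xy by auto
  moreover have "edges G = all_edges (verts G) - {{x, y}}" using e f(3) xy(1) by blast
  ultimately show ?thesis by (rule that)
qed

lemma path_edges_three: "path_edges [a, b, c] = {{a, b}, {b, c}}"
proof -
  have "{i. Suc i < length [a, b, c]} = {0, 1}" by auto
  then show ?thesis unfolding path_edges_def setcompr_eq_image by simp
qed

text \<open>Only the pair \<open>x\<close>, \<open>y\<close> needs a longer path. Coloring
  \<open>u\<close> and its edges to \<open>x\<close> and \<open>y\<close> alike leaves 3 vertices
  and 3 edges with own colors, so there are 7 in all. The general formula would give only 6, which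
  is why the diamond is excluded.\<close>

lemma tmc_diamond:
  assumes "connected_graph G" "card (verts G) = 4" "card (edges G) = 5"
  shows "7 \<le> tmc G"
proof -
  note f = connected_graph_facts[OF assms(1)]
  have sG: "simple_graph G" using assms(1) by (simp add: connected_graph_def)
  obtain x y u v where d: "verts G = {x, y, u, v}" "distinct [x, y, u, v]"
    "edges G = all_edges (verts G) - {{x, y}}"
    using diamond_edges[OF assms] .
  have E: "{x, u} \<in> edges G" "{u, y} \<in> edges G"
    using d by (auto simp: doubleton_in_all_edges doubleton_eq_iff)
  let ?C = "{{x, u}, {u, y}}"
  have pre: "{u} \<subseteq> verts G" "?C \<subseteq> edges G" "{u} \<noteq> {} \<or> ?C \<noteq> {}" using E d(1) by auto
  obtain cv ce where c: "\<And>w. w \<in> {u} \<Longrightarrow> cv w = 0" "\<And>e. e \<in> ?C \<Longrightarrow> ce e = 0"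
    "num_colors G cv ce = Suc (card (verts G - {u}) + card (edges G - ?C))"
    using block_coloring[OF f(1,2) pre] by blast
  have pxy: "path_between G x [x, u, y] y" "path_between G y [y, u, x] x"
    using d E by (auto simp: path_between_def is_path_def nth_Cons less_Suc_eq insert_commute split: nat.splits)
  have mxy: "total_mono_path cv ce [x, u, y]" "total_mono_path cv ce [y, u, x]"
    unfolding total_mono_path_def path_edges_three
    by (rule exI[of _ 0], use c(1,2) in \<open>simp add: internal_verts_def insert_commute\<close>)+
  have "TMC_coloring G cv ce"
    unfolding TMC_coloring_def
  proof (intro ballI impI)
    fix a b assume ab: "a \<in> verts G" "b \<in> verts G" "a \<noteq> b"
    show "\<exists>p. path_between G a p b \<and> total_mono_path cv ce p"
    proof (cases "{a, b} = {x, y}")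
      case True
      then show ?thesis using pxy mxy by (metis doubleton_eq_iff)
    next
      case False
      then have "{a, b} \<in> edges G" using ab d(3) by (simp add: doubleton_in_all_edges)
      then show ?thesis using edge_mono_path[OF sG] by blast
    qed
  qed
  moreover have "card (verts G - {u}) = 3" using assms(2) d(1) by simp
  moreover have "card (edges G - ?C) = 3"
  proof -
    have "card ?C = 2" using d(2) by (simp add: doubleton_eq_iff)
    then show ?thesis using E assms(3) by (simp add: card_Diff_subset)
  qed
  ultimately show ?thesis using tmc_ge[OF assms(1), of cv ce] c(3) by simp
qed

section \<open>Recognizing the triangle and the diamond by their numbers of vertices and
  edges\<close>

lemma graph_iso_cards:
  assumes "graph_iso G H" "simple_graph G"
  shows "card (verts G) = card (verts H)" "card (edges G) = card (edges H)"
proof -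
  obtain f where f: "bij_betw f (verts G) (verts H)" "edges H = (`) f ` edges G"
    using assms(1) by (auto simp: graph_iso_def)
  then show "card (verts G) = card (verts H)" by (simp add: bij_betw_same_card)
  have "inj_on ((`) f) (Pow (verts G))" using f(1) by (simp add: bij_betw_def inj_on_image_Pow)
  moreover have "edges G \<subseteq> Pow (verts G)" using assms(2) by (auto simp: simple_graph_def all_edges_def)
  ultimately have "inj_on ((`) f) (edges G)" by (rule inj_on_subset)
  then show "card (edges G) = card (edges H)" using f(2) by (simp add: card_image)
qed

lemma image_all_edges:
  assumes "bij_betw f V W"
  shows "(`) f ` all_edges V = all_edges W"
proof -
  have inj: "inj_on f V" and im: "f ` V = W" using assms by (auto simp: bij_betw_def)
  show ?thesis
  proof (intro equalityI subsetI)
    fix e assume "e \<in> (`) f ` all_edges V"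
    then obtain d where d: "d \<subseteq> V" "card d = 2" "e = f ` d" by (auto simp: all_edges_def)
    then have "card e = 2" using inj by (metis card_image inj_on_subset)
    then show "e \<in> all_edges W" using d im by (auto simp: all_edges_def)
  next
    fix e assume "e \<in> all_edges W"
    then have e: "e \<subseteq> f ` V" "card e = 2" using im by (auto simp: all_edges_def)
    then obtain d where d: "d \<subseteq> V" "e = f ` d" by (auto simp: subset_image_iff)
    then have "card d = 2" using e(2) inj by (metis card_image inj_on_subset)
    then show "e \<in> (`) f ` all_edges V" using d by (auto simp: all_edges_def)
  qed
qed

lemma graph_iso_triangle:
  assumes "connected_graph G"
  shows "graph_iso G (complete_graph 3) \<longleftrightarrow> card (verts G) = 3 \<and> card (edges G) = 3"
proof
  assume iso: "graph_iso G (complete_graph 3)"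
  have "simple_graph G" using assms by (simp add: connected_graph_def)
  from graph_iso_cards[OF iso this] show "card (verts G) = 3 \<and> card (edges G) = 3"
    by (simp add: complete_graph_def card_all_edges choose_two)
next
  note f = connected_graph_facts[OF assms]
  assume c: "card (verts G) = 3 \<and> card (edges G) = 3"
  then have E: "edges G = all_edges (verts G)"
    using f by (intro card_subset_eq) (simp_all add: finite_all_edges card_all_edges choose_two)
  obtain h where "bij_betw h (verts G) {..<3::nat}"
    using finite_same_card_bij[of "verts G" "{..<3::nat}"] f(1) c by auto
  then show "graph_iso G (complete_graph 3)"
    unfolding graph_iso_def complete_graph_def E
    using image_all_edges[of h "verts G" "{..<3::nat}"] by auto
qed

lemma diamond_verts:
  "verts (complete_multipartite [2, 1, 1]) = {(0, 0), (0, 1), (1, 0), (2, 0)}"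
  by (auto simp: complete_multipartite_def Let_def nth_Cons less_Suc_eq numeral_3_eq_3 numeral_2_eq_2 split: nat.splits)

lemma all_edges_minus: "all_edges V - {d} = {{x, y} |x y. x \<in> V \<and> y \<in> V \<and> x \<noteq> y \<and> {x, y} \<noteq> d}"
  by (auto simp: all_edges_def card_2_iff)

text \<open>The only two distinct vertices in a common part are \<open>(0, 0)\<close> and
  \<open>(0, 1)\<close>.\<close>

lemma diamond_multipartite_edges:
  "edges (complete_multipartite [2, 1, 1]) =
    all_edges {(0, 0), (0, 1), (1, 0), (2, 0)} - {{(0, 0), (0, 1)}}" (is "_ = all_edges ?V - _")
proof -
  have "edges (complete_multipartite [2, 1, 1]) = {{x, y} |x y. x \<in> ?V \<and> y \<in> ?V \<and> fst x \<noteq> fst y}"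
    using diamond_verts by (simp add: complete_multipartite_def Let_def)
  also have "\<dots> = {{x, y} |x y. x \<in> ?V \<and> y \<in> ?V \<and> x \<noteq> y \<and> {x, y} \<noteq> {(0, 0), (0, 1)}}"
  proof -
    have "fst x \<noteq> fst y \<longleftrightarrow> x \<noteq> y \<and> {x, y} \<noteq> {(0, 0), (0, 1)}" if "x \<in> ?V" "y \<in> ?V" for x y
      using that by (auto simp: doubleton_eq_iff)
    then show ?thesis by (intro Collect_cong ex_cong1 conj_cong refl)
  qed
  also have "\<dots> = all_edges ?V - {{(0, 0), (0, 1)}}" by (rule all_edges_minus[symmetric])
  finally show ?thesis .
qed

lemma graph_iso_diamond:
  assumes "connected_graph G"
  shows "graph_iso G (complete_multipartite [2, 1, 1]) \<longleftrightarrow> card (verts G) = 4 \<and> card (edges G) = 5"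
proof
  assume iso: "graph_iso G (complete_multipartite [2, 1, 1])"
  have "simple_graph G" using assms by (simp add: connected_graph_def)
  note c = graph_iso_cards[OF iso this]
  have "card (edges (complete_multipartite [2, 1, 1])) = 5"
    unfolding diamond_multipartite_edges
    by (subst card_Diff_subset) (auto simp: card_all_edges choose_two doubleton_in_all_edges)
  then show "card (verts G) = 4 \<and> card (edges G) = 5" using c unfolding diamond_verts by simp
next
  assume c: "card (verts G) = 4 \<and> card (edges G) = 5"
  obtain x y u v where d: "verts G = {x, y, u, v}" "distinct [x, y, u, v]"
    "edges G = all_edges (verts G) - {{x, y}}"
    using diamond_edges[OF assms] c by blast
  \<comment> \<open>The missing pair \<open>x\<close>, \<open>y\<close> goes to the part of size
    2.\<close>
  define f where "f = (\<lambda>w. if w = x then (0, 0) else if w = y then (0, 1) else if w = u then (1, 0) else (2::nat, 0::nat))"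
  let ?V = "{(0, 0), (0, 1), (1, 0), (2::nat, 0::nat)}"
  have b: "bij_betw f (verts G) ?V"
    using d(1,2) by (auto simp: bij_betw_def inj_on_def f_def)
  then have inj: "inj_on ((`) f) (Pow (verts G))" by (simp add: bij_betw_def inj_on_image_Pow)
  have "(`) f ` edges G = (`) f ` all_edges (verts G) - (`) f ` {{x, y}}"
    unfolding d(3) by (rule inj_on_image_set_diff[OF inj]) (use d(1) in \<open>auto simp: all_edges_def\<close>)
  also have "\<dots> = edges (complete_multipartite [2, 1, 1])"
  proof -
    have "f x = (0, 0)" "f y = (0, 1)" using d(2) by (auto simp: f_def)
    then show ?thesis unfolding image_all_edges[OF b] diamond_multipartite_edges by simp
  qed
  finally show "graph_iso G (complete_multipartite [2, 1, 1])"
    unfolding graph_iso_def diamond_verts using b by metis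
qed

section \<open>Case distinction by the difference between the numbers of edges and vertices\<close>

theorem theorem6:
  fixes G :: "'a graph"
  assumes "connected_graph G"
  shows "tmc G = 6 \<longleftrightarrow>
    graph_iso G (complete_graph 3) \<or>
    (tree G \<and> num_leaves G = 5) \<or>
    (unicyclic G \<and> max_leaves G = 4) \<or>
    (bicyclic G \<and> max_leaves G = 3 \<and> \<not> graph_iso G (complete_multipartite [2, 1, 1]))"
proof -
  define n where "n = card (verts G)"
  define m where "m = card (edges G)"
  note f = connected_graph_facts[OF assms]
  have n0: "n \<noteq> 0" using f(1,4) by (simp add: n_def)
  have tree: "tree G \<longleftrightarrow> n = Suc m" and nm: "n \<le> Suc m"
    using connected_card_edges[OF assms] by (simp_all add: n_def m_def)
  have uni: "unicyclic G \<longleftrightarrow> m = n" and bi: "bicyclic G \<longleftrightarrow> m = n + 1"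
    using assms by (simp_all add: unicyclic_def bicyclic_def n_def m_def)
  have K3: "graph_iso G (complete_graph 3) \<longleftrightarrow> n = 3 \<and> m = 3"
    and K4: "graph_iso G (complete_multipartite [2, 1, 1]) \<longleftrightarrow> n = 4 \<and> m = 5"
    using graph_iso_triangle[OF assms] graph_iso_diamond[OF assms] by (simp_all add: n_def m_def)
  \<comment> \<open>Rules out cycles on too few vertices, so that the triangle and the diamond are
    the only unicyclic or bicyclic graphs outside the range of \<open>sparse\<close>.\<close>
  have "m \<le> n choose 2"
    using card_mono[OF finite_all_edges[OF f(1)] f(3)] f(1) by (simp add: card_all_edges n_def m_def)
  then have m1: "n = 1 \<Longrightarrow> m = 0" and m2: "n = 2 \<Longrightarrow> m \<le> 1" and m3: "n = 3 \<Longrightarrow> m \<le> 3"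
    by (auto simp: choose_two)
  have low: "m + 2 + max_leaves G \<le> tmc G + n"
    using tmc_lower_bound[OF assms] by (simp add: n_def m_def)
  have sparse: "tmc G + n = m + 2 + max_leaves G" if "m \<le> n + 1" "m + 4 \<le> 2 * n"
    using tmc_sparse[OF assms] that by (simp add: n_def m_def)
  have up: "tmc G \<le> n + m"
    using tmc_le[OF assms num_colors_le[OF assms]] by (simp add: n_def m_def)
  have leaves: "3 \<le> max_leaves G" if "n < m"
    using max_leaves_ge_3[OF assms] that by (simp add: n_def m_def)
  consider "n = Suc m" | "m = n" | "m = n + 1" | "n + 2 \<le> m" using nm by linarith
  then show ?thesis
  proof cases
    case 1
    then have l: "max_leaves G = num_leaves G" using tree max_leaves_tree by blast
    have "tmc G = 6 \<longleftrightarrow> num_leaves G = 5"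
    proof (cases "3 \<le> n")
      case True
      then show ?thesis using sparse 1 l by linarith
    next
      case False
      \<comment> \<open>At most 2 vertices allow at most 3 colors and, by \<open>low\<close>, at
        most 2 leaves, so both sides fail.\<close>
      then show ?thesis using up low 1 l by linarith
    qed
    then show ?thesis using 1 tree uni bi K3 by auto
  next
    case 2
    then have "n \<noteq> 1" "n \<noteq> 2" using m1 m2 by auto
    then have "3 \<le> n" using n0 by linarith
    show ?thesis
    proof (cases "n = 3")
      case True
      then show ?thesis using 2 tmc_triangle[OF assms] K3 by (simp add: n_def m_def)
    next
      case False
      then have "tmc G = 2 + max_leaves G" using \<open>3 \<le> n\<close> sparse 2 by linarith
      then show ?thesis using 2 False tree uni bi K3 by auto
    qed
  next
    case 3
    then have "n \<noteq> 1" "n \<noteq> 2" "n \<noteq> 3" using m1 m2 m3 by auto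
    then have "4 \<le> n" using n0 by linarith
    show ?thesis
    proof (cases "n = 4")
      case True
      then have "7 \<le> tmc G" using 3 tmc_diamond[OF assms] by (simp add: n_def m_def)
      then show ?thesis using 3 True K3 K4 tree uni by auto
    next
      case False
      then have "tmc G = 3 + max_leaves G" using \<open>4 \<le> n\<close> sparse 3 by linarith
      then show ?thesis using 3 False tree uni bi K3 K4 by auto
    qed
  next
    case 4
    \<comment> \<open>At least two edges more than vertices and at least 3 leaves give 2 + 2 + 3
      colors.\<close>
    then have "7 \<le> tmc G" using low leaves by linarith
    moreover have "\<not> (n = 3 \<and> m = 3)" using 4 by linarith
    ultimately show ?thesis using 4 tree uni bi K3 by auto
  qed
qed

end
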